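(* Let $G$ be a finite connected simple graph with at least one edge. Then $G$ is walk-regular if and only if for every $n\in\mathbb{N}$ and all $x,y\in V(G)$ one has $\Pr_x(Z(n)=x)=\Pr_y(Z(n)=y)$.
   Context: Graphs are undirected. A graph $G$ is called walk-regular if, for every $n\in\mathbb{N}$, the number of closed walks in $G$ of length $n$ starting (and ending) at a vertex $x$ is independent of the choice of $x\in V(G)$. Here $(Z(n))_{n\ge 0}$ denotes simple random walk on $G$ (at each step the walk moves to a neighbour of the current vertex chosen uniformly at random), and $\Pr_x(Z(n)=x)$ denotes the probability that simple random walk started at $x$ is at its starting vertex $x$ after $n$ steps. *)

theory Defs
  imports "HOL-Probability.Probability_Mass_Function" "Graph_Theory.Digraph_Component"
begin

(* As in the AFP entry Graph_Theory, a finite simple (undirected) graph is a digraph in the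
   locale graph: finite, loopfree, without parallel arcs and with a symmetric arc relation, so
   that each undirected edge {x, y} is represented by the two arcs (x, y) and (y, x). *)

definition closed_walks :: "('a, 'b) pre_digraph \<Rightarrow> nat \<Rightarrow> 'a \<Rightarrow> 'b awalk set" where
  "closed_walks G n x = {p. pre_digraph.awalk G x p x \<and> length p = n}"

definition walk_regular :: "('a, 'b) pre_digraph \<Rightarrow> bool" where
  "walk_regular G \<longleftrightarrow>
    (\<forall>n. \<forall>x\<in>verts G. \<forall>y\<in>verts G. card (closed_walks G n x) = card (closed_walks G n y))"

definition neighbours :: "('a, 'b) pre_digraph \<Rightarrow> 'a \<Rightarrow> 'a set" where
  "neighbours G x = {y. x \<rightarrow>\<^bsub>G\<^esub> y}"

(* srw G x n is the law of Z(n) under Pr_x. It is meaningful only if no visited vertex is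
   isolated, since pmf_of_set {} is unspecified; a connected simple graph with an edge has no
   isolated vertices. *)
primrec srw :: "('a, 'b) pre_digraph \<Rightarrow> 'a \<Rightarrow> nat \<Rightarrow> 'a pmf" where
  "srw G x 0 = return_pmf x"
| "srw G x (Suc n) = bind_pmf (srw G x n) (\<lambda>z. pmf_of_set (neighbours G z))"

definition return_prob :: "('a, 'b) pre_digraph \<Rightarrow> nat \<Rightarrow> 'a \<Rightarrow> real" where
  "return_prob G n x = measure_pmf.prob (srw G x n) {z. z = x}"

end

theory Submission
  imports Defs
begin

text \<open>
  Closed walks of length 2 count the degree, so walk-regularity implies regularity. Conversely, if
  the return probabilities do not depend on the starting vertex, neither do those of the lazy walk,
  which converge to the stationary distribution; as the latter is proportional to the degree, the
  graph is again regular. In a \<open>d\<close>-regular graph, the number of closed walks of length \<open>n\<close> is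
  \<open>d ^ n\<close> times the return probability.
\<close>

section \<open>Neighbourhoods and degrees in a connected graph\<close>

locale connected_graph = graph +
  assumes connected: "Digraph_Component.connected G"
    and arcs_nonempty: "arcs G \<noteq> {}"
begin

abbreviation N :: "'a \<Rightarrow> 'a set" where "N \<equiv> neighbours G"

abbreviation deg :: "'a \<Rightarrow> nat" where "deg x \<equiv> card (N x)"

lemma neighbours_subset: "N x \<subseteq> verts G"
  using adj_in_verts by (auto simp: neighbours_def)

lemma finite_neighbours [simp]: "finite (N x)"
  using neighbours_subset finite_verts by (rule finite_subset)

lemma neighbours_sym: "y \<in> N x \<longleftrightarrow> x \<in> N y"
  using graph_symmetric by (auto simp: neighbours_def)

lemma reachable_verts:
  assumes "x \<in> verts G" "y \<in> verts G"
  shows "x \<rightarrow>\<^sup>* y"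
  using symmetric_connected_imp_strongly_connected[OF sym_arcs connected] assms
  by (auto simp: strongly_connected_def)

text \<open>Makes \<open>pmf_of_set (N x)\<close> a genuine uniform distribution. If
  \<open>x\<close> is not itself the tail of a chosen arc, the first step of a path from
  \<open>x\<close> to that tail yields a neighbour.\<close>

lemma neighbours_nonempty:
  assumes "x \<in> verts G"
  shows "N x \<noteq> {}"
proof -
  obtain e where e: "e \<in> arcs G" using arcs_nonempty by blast
  have edge: "tail G e \<rightarrow>\<^bsub>G\<^esub> head G e" using e by (simp add: in_arcs_imp_in_arcs_ends)
  show ?thesis
  proof (cases "x = tail G e")
    case True
    then show ?thesis using edge by (auto simp: neighbours_def)
  next
    case False
    have "x \<rightarrow>\<^sup>* tail G e" using assms e by (simp add: reachable_verts)
    then show ?thesis using False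
      by (cases rule: converse_reachable_cases) (auto simp: neighbours_def)
  qed
qed

lemma deg_pos: "x \<in> verts G \<Longrightarrow> deg x > 0"
  using neighbours_nonempty by (simp add: card_gt_0_iff)

text \<open>The transition operator of simple random walk, acting on functions of the starting
  vertex.\<close>

definition avg :: "('a \<Rightarrow> real) \<Rightarrow> 'a \<Rightarrow> real" where
  "avg f x = (\<Sum>y\<in>N x. f y) / deg x"

text \<open>The transition operator of the walk that stays put with probability 1/2. Laziness
  removes the parity obstruction to convergence on bipartite graphs.\<close>

definition lazy :: "('a \<Rightarrow> real) \<Rightarrow> 'a \<Rightarrow> real" where
  "lazy f x = (f x + avg f x) / 2"

abbreviation ind :: "'a \<Rightarrow> 'a \<Rightarrow> real" where
  "ind y \<equiv> \<lambda>x. if x = y then 1 else 0"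

subsection \<open>Walks and the averaging operator\<close>

text \<open>\<open>srw\<close> appends a last step, whereas \<open>avg\<close> acts on the starting
  point; associativity of \<open>bind_pmf\<close> converts one recursion into the other.\<close>

lemma srw_Suc_first_step: "srw G x (Suc n) = bind_pmf (pmf_of_set (N x)) (\<lambda>z. srw G z n)"
proof (induction n)
  case 0
  show ?case by (simp add: bind_return_pmf bind_return_pmf')
next
  case (Suc n)
  have "srw G x (Suc (Suc n)) = bind_pmf (srw G x (Suc n)) (\<lambda>z. pmf_of_set (N z))" by simp
  also have "\<dots> = bind_pmf (pmf_of_set (N x)) (\<lambda>z. srw G z (Suc n))"
    by (subst Suc) (simp add: bind_assoc_pmf)
  finally show ?case .
qed

lemma pmf_srw: "x \<in> verts G \<Longrightarrow> pmf (srw G x n) y = (avg ^^ n) (ind y) x"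
proof (induction n arbitrary: x)
  case 0
  show ?case by simp
next
  case (Suc n)
  have "pmf (srw G x (Suc n)) y = (\<Sum>z\<in>N x. pmf (srw G z n) y) / deg x"
    unfolding srw_Suc_first_step pmf_bind
    using neighbours_nonempty[OF Suc.prems] by (simp add: integral_pmf_of_set)
  also have "\<dots> = avg ((avg ^^ n) (ind y)) x"
    unfolding avg_def[of _ x] using Suc.IH neighbours_subset[of x]
    by (intro arg_cong2[of _ _ _ _ "(/)"] sum.cong) auto
  finally show ?case by simp
qed

lemma return_prob_avg: "x \<in> verts G \<Longrightarrow> return_prob G n x = (avg ^^ n) (ind x) x"
  by (simp add: return_prob_def measure_pmf_single pmf_srw)

text \<open>Two endpoints are kept apart because deleting the first arc of a closed walk leaves a
  walk that is no longer closed.\<close>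

definition walks :: "nat \<Rightarrow> 'a \<Rightarrow> 'a \<Rightarrow> 'b awalk set" where
  "walks n x y = {p. awalk x p y \<and> length p = n}"

lemma walks_0: "x \<in> verts G \<Longrightarrow> walks 0 x y = (if x = y then {[]} else {})"
  by (auto simp: walks_def awalk_Nil_iff)

lemma walks_Suc: "walks (Suc n) x y = (\<Union>e\<in>out_arcs G x. (#) e ` walks n (head G e) y)"
  by (auto simp: walks_def out_arcs_def awalk_Cons_iff length_Suc_conv)

lemma finite_walks: "finite (walks n x y)"
proof (rule finite_subset)
  show "walks n x y \<subseteq> {p. set p \<subseteq> arcs G \<and> length p = n}" by (auto simp: walks_def awalk_def)
qed (simp add: finite_lists_length_eq)

text \<open>Absence of parallel arcs gives injectivity, so that sums over outgoing arcs become sums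
  over neighbours.\<close>

lemma bij_betw_head_out_arcs: "bij_betw (head G) (out_arcs G x) (N x)"
  unfolding bij_betw_def
proof
  show "inj_on (head G) (out_arcs G x)"
    by (auto simp: inj_on_def out_arcs_def arc_to_ends_def intro: no_multi_arcs)
  show "head G ` out_arcs G x = N x"
    by (auto simp: out_arcs_def neighbours_def arcs_ends_conv)
qed

lemma card_walks_Suc: "card (walks (Suc n) x y) = (\<Sum>z\<in>N x. card (walks n z y))"
proof -
  have "card (walks (Suc n) x y) = (\<Sum>e\<in>out_arcs G x. card ((#) e ` walks n (head G e) y))"
    unfolding walks_Suc by (rule card_UN_disjoint) (auto simp: finite_walks)
  also have "\<dots> = (\<Sum>e\<in>out_arcs G x. card (walks n (head G e) y))"
    by (simp add: card_image)
  also have "\<dots> = (\<Sum>z\<in>N x. card (walks n z y))"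
    by (rule sum.reindex_bij_betw[OF bij_betw_head_out_arcs])
  finally show ?thesis .
qed

lemma closed_walks_eq: "closed_walks G n x = walks n x x"
  by (simp add: closed_walks_def walks_def)

text \<open>Such a walk goes to a neighbour and comes back, and by symmetry there is exactly one way
  back.\<close>

lemma card_closed_walks_2: "x \<in> verts G \<Longrightarrow> card (closed_walks G 2 x) = deg x"
proof -
  assume x: "x \<in> verts G"
  have "card (walks 1 z x) = 1" if "z \<in> N x" for z
  proof -
    have "card (walks 1 z x) = (\<Sum>w\<in>N z. if w = x then 1 else 0)"
      using card_walks_Suc[of 0 z x] neighbours_subset[of z]
      by (simp add: walks_0 subset_iff if_distrib cong: sum.cong if_cong)
    then show ?thesis using that by (simp add: neighbours_sym)
  qed
  then show ?thesis
    using card_walks_Suc[of 1 x x] by (simp add: closed_walks_eq numeral_2_eq_2)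
qed

text \<open>Both sides obey the same first-step recursion, since summing over \<open>N x\<close> is
  \<open>d\<close> times averaging over it.\<close>

lemma card_walks_regular:
  assumes "\<And>z. z \<in> verts G \<Longrightarrow> deg z = d"
  shows "x \<in> verts G \<Longrightarrow> real (card (walks n x y)) = real d ^ n * (avg ^^ n) (ind y) x"
proof (induction n arbitrary: x)
  case 0
  then show ?case by (simp add: walks_0)
next
  case (Suc n)
  have "d > 0" using assms[OF Suc.prems] deg_pos[OF Suc.prems] by simp
  have "real (card (walks (Suc n) x y)) = (\<Sum>z\<in>N x. real d ^ n * (avg ^^ n) (ind y) z)"
    using Suc.IH neighbours_subset by (simp add: card_walks_Suc subset_iff cong: sum.cong)
  also have "\<dots> = real d ^ Suc n * avg ((avg ^^ n) (ind y)) x"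
    using \<open>d > 0\<close> by (simp add: avg_def[of _ x] assms[OF Suc.prems] flip: sum_distrib_left)
  finally show ?case by simp
qed

lemma card_closed_walks_regular:
  assumes "\<And>z. z \<in> verts G \<Longrightarrow> deg z = d" and "x \<in> verts G"
  shows "real (card (closed_walks G n x)) = real d ^ n * return_prob G n x"
  using assms by (simp add: closed_walks_eq card_walks_regular return_prob_avg)

subsection \<open>Convergence of the lazy walk\<close>

lemma lazy_add: "lazy (\<lambda>z. f z + g z) = (\<lambda>z. lazy f z + lazy g z)"
  by (simp add: fun_eq_iff lazy_def avg_def sum.distrib add_divide_distrib)

lemma lazy_scale: "lazy (\<lambda>z. c * f z) = (\<lambda>z. c * lazy f z)"
  by (simp add: fun_eq_iff lazy_def avg_def sum_distrib_left[symmetric] algebra_simps)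

lemma lazy_pow_add: "(lazy ^^ n) (\<lambda>z. f z + g z) = (\<lambda>z. (lazy ^^ n) f z + (lazy ^^ n) g z)"
  by (induction n) (simp_all add: lazy_add)

lemma lazy_pow_scale: "(lazy ^^ n) (\<lambda>z. c * f z) = (\<lambda>z. c * (lazy ^^ n) f z)"
  by (induction n) (simp_all add: lazy_scale)

lemma lazy_mono:
  assumes "\<And>z. z \<in> verts G \<Longrightarrow> f z \<le> g z" and "x \<in> verts G"
  shows "lazy f x \<le> lazy g x"
proof -
  have "(\<Sum>y\<in>N x. f y) \<le> (\<Sum>y\<in>N x. g y)"
    using assms(1) neighbours_subset by (intro sum_mono) auto
  then show ?thesis using assms by (simp add: lazy_def avg_def divide_right_mono add_mono)
qed

lemma lazy_pow_mono:
  assumes "\<And>z. z \<in> verts G \<Longrightarrow> f z \<le> g z"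
  shows "x \<in> verts G \<Longrightarrow> (lazy ^^ n) f x \<le> (lazy ^^ n) g x"
  by (induction n arbitrary: x) (simp_all add: assms lazy_mono)

lemma lazy_pow_const: "x \<in> verts G \<Longrightarrow> (lazy ^^ n) (\<lambda>_. c) x = c"
proof (induction n arbitrary: x)
  case (Suc n)
  have "(\<Sum>y\<in>N x. (lazy ^^ n) (\<lambda>_. c) y) = (\<Sum>y\<in>N x. c)"
    using Suc.IH neighbours_subset by (intro sum.cong) auto
  then show ?case using Suc neighbours_nonempty[OF Suc.prems]
    by (simp add: lazy_def[of _ x] avg_def[of _ x])
qed simp

text \<open>The degree measure is stationary: adjacency is symmetric, so swapping the double sum
  over adjacent pairs turns the sum of neighbour values into a degree weight.\<close>

lemma lazy_stationary:
  fixes f :: "'a \<Rightarrow> real"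
  shows "(\<Sum>z\<in>verts G. deg z * lazy f z) = (\<Sum>z\<in>verts G. deg z * f z)"
proof -
  \<comment> \<open>Extending inner sums to all vertices makes their range independent of
    \<open>z\<close>, as \<open>sum.swap\<close> requires.\<close>
  have extend: "sum g (N z) = (\<Sum>y\<in>verts G. if y \<in> N z then g y else 0)"
    for g :: "'a \<Rightarrow> real" and z
    by (simp add: neighbours_subset Int_absorb1 flip: sum.inter_restrict)
  have "(\<Sum>z\<in>verts G. deg z * avg f z) = (\<Sum>z\<in>verts G. \<Sum>y\<in>N z. f y)"
    by (intro sum.cong) (use deg_pos in \<open>auto simp: avg_def\<close>)
  also have "\<dots> = (\<Sum>z\<in>verts G. \<Sum>y\<in>verts G. if y \<in> N z then f y else 0)"
    by (simp only: extend)
  also have "\<dots> = (\<Sum>y\<in>verts G. \<Sum>z\<in>verts G. if z \<in> N y then f y else 0)"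
    by (subst sum.swap) (intro sum.cong refl if_cong neighbours_sym)
  also have "\<dots> = (\<Sum>y\<in>verts G. deg y * f y)"
    by (simp only: extend[symmetric] sum_constant)
  finally show ?thesis
    by (simp add: lazy_def algebra_simps add_divide_distrib sum.distrib flip: sum_divide_distrib)
qed

lemma lazy_pow_stationary:
  fixes f :: "'a \<Rightarrow> real"
  shows "(\<Sum>z\<in>verts G. deg z * (lazy ^^ n) f z) = (\<Sum>z\<in>verts G. deg z * f z)"
  by (induction n) (simp_all add: lazy_stationary)

section \<open>Positivity, minorization and contraction\<close>

lemma lazy_pow_ind_nonneg: "(lazy ^^ n) (ind v) x \<ge> 0"
  by (induction n arbitrary: x) (simp_all add: lazy_def avg_def sum_nonneg)

text \<open>The walk may stay at \<open>x\<close> during the additional steps. This later allows one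
  exponent to serve all vertices.\<close>

lemma lazy_pow_ind_pos_mono:
  assumes "(lazy ^^ n) (ind v) x > 0" and "n \<le> m"
  shows "(lazy ^^ m) (ind v) x > 0"
  using assms(2)
proof (induction m rule: dec_induct)
  case (step m)
  have "avg ((lazy ^^ m) (ind v)) x \<ge> 0" by (simp add: avg_def sum_nonneg lazy_pow_ind_nonneg)
  then show ?case using step.IH by (simp add: lazy_def[of _ x])
qed (rule assms(1))

lemma lazy_pow_ind_pos: "x \<rightarrow>\<^sup>* v \<Longrightarrow> \<exists>n. (lazy ^^ n) (ind v) x > 0"
proof (induction rule: converse_reachable_induct)
  case base
  show ?case by (rule exI[of _ 0]) simp
next
  case (step x y)
  then obtain n where n: "(lazy ^^ n) (ind v) y > 0" by blast
  have y: "y \<in> N x" using step.hyps by (simp add: neighbours_def)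
  have "(\<Sum>z\<in>N x. (lazy ^^ n) (ind v) z) > 0"
    using n y by (intro sum_pos2[of _ y]) (simp_all add: lazy_pow_ind_nonneg)
  moreover have "deg x > 0" using y by (auto simp: card_gt_0_iff)
  ultimately have "(lazy ^^ Suc n) (ind v) x > 0"
    by (simp add: lazy_def avg_def lazy_pow_ind_nonneg add_nonneg_pos)
  then show ?case by blast
qed

text \<open>A Doeblin condition: from every start, the lazy walk is at \<open>v\<close> after
  \<open>m\<close> steps with probability at least \<epsilon>. Finiteness of the vertex set lets a
  maximal time and a minimal probability be taken.\<close>

lemma lazy_minorization:
  assumes "v \<in> verts G"
  obtains m \<epsilon> where "\<epsilon> > 0" "\<epsilon> \<le> 1" "\<And>x. x \<in> verts G \<Longrightarrow> (lazy ^^ m) (ind v) x \<ge> \<epsilon>"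
proof -
  have "\<forall>x\<in>verts G. \<exists>n. (lazy ^^ n) (ind v) x > 0"
    using assms lazy_pow_ind_pos reachable_verts by blast
  then obtain t where t: "\<And>x. x \<in> verts G \<Longrightarrow> (lazy ^^ t x) (ind v) x > 0" by metis
  define m where "m = Max (t ` verts G)"
  define \<epsilon> where "\<epsilon> = Min ((\<lambda>x. (lazy ^^ m) (ind v) x) ` verts G)"
  have ne: "verts G \<noteq> {}" using assms by blast
  have pos: "(lazy ^^ m) (ind v) x > 0" if "x \<in> verts G" for x
    by (rule lazy_pow_ind_pos_mono[OF t[OF that]]) (use that in \<open>simp add: m_def\<close>)
  have lower: "(lazy ^^ m) (ind v) x \<ge> \<epsilon>" if "x \<in> verts G" for x
    using that by (simp add: \<epsilon>_def)
  have "\<epsilon> > 0" using pos ne by (simp add: \<epsilon>_def)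
  moreover have "\<epsilon> \<le> 1"
  proof -
    have "(lazy ^^ m) (ind v) v \<le> (lazy ^^ m) (\<lambda>_. 1) v"
      using assms by (intro lazy_pow_mono) auto
    then show ?thesis using lower[OF assms] lazy_pow_const[OF assms, of m 1] by simp
  qed
  ultimately show thesis using lower that by blast
qed

text \<open>Each value of \<open>(lazy ^^ m) f\<close> is an average of \<open>f\<close> giving
  weight at least \<epsilon> to the common value \<open>f v\<close>, so both bounds move towards
  \<open>f v\<close>.\<close>

lemma lazy_pow_contraction:
  assumes v: "v \<in> verts G"
    and minor: "\<And>x. x \<in> verts G \<Longrightarrow> (lazy ^^ m) (ind v) x \<ge> \<epsilon>"
    and bounds: "\<And>z. z \<in> verts G \<Longrightarrow> a \<le> f z \<and> f z \<le> b"
  shows "\<exists>a' b'. b' - a' = (1 - \<epsilon>) * (b - a) \<and>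
    (\<forall>z\<in>verts G. a' \<le> (lazy ^^ m) f z \<and> (lazy ^^ m) f z \<le> b')"
proof (intro exI conjI ballI)
  \<comment> \<open>The new bounds are the convex combinations of \<open>b\<close> and of
    \<open>a\<close> with \<open>f v\<close>, the latter having weight \<epsilon>.\<close>
  show "(b + (f v - b) * \<epsilon>) - (a + (f v - a) * \<epsilon>) = (1 - \<epsilon>) * (b - a)"
    by (simp add: algebra_simps)
next
  fix x assume x: "x \<in> verts G"
  \<comment> \<open>Used for the functions equal to \<open>f v\<close> at \<open>v\<close> and to
    \<open>a\<close>, respectively \<open>b\<close>, elsewhere; they bound \<open>f\<close> from
    below and above.\<close>
  have affine: "(lazy ^^ m) (\<lambda>z. c + e * ind v z) x = c + e * (lazy ^^ m) (ind v) x" for c e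
    by (subst lazy_pow_add) (simp only: lazy_pow_scale lazy_pow_const[OF x])
  have "a + (f v - a) * \<epsilon> \<le> a + (f v - a) * (lazy ^^ m) (ind v) x"
    using minor[OF x] bounds[OF v] by (intro add_left_mono mult_left_mono) auto
  also have "\<dots> \<le> (lazy ^^ m) f x"
    unfolding affine[symmetric] using bounds x by (intro lazy_pow_mono) auto
  finally show "a + (f v - a) * \<epsilon> \<le> (lazy ^^ m) f x" .
  have "(lazy ^^ m) f x \<le> b + (f v - b) * (lazy ^^ m) (ind v) x"
    unfolding affine[symmetric] using bounds x by (intro lazy_pow_mono) auto
  also have "\<dots> \<le> b + (f v - b) * \<epsilon>"
    using minor[OF x] bounds[OF v] by (intro add_left_mono mult_left_mono_neg) auto
  finally show "(lazy ^^ m) f x \<le> b + (f v - b) * \<epsilon>" .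
qed

lemma lazy_pow_oscillation:
  assumes v: "v \<in> verts G"
    and minor: "\<And>x. x \<in> verts G \<Longrightarrow> (lazy ^^ m) (ind v) x \<ge> \<epsilon>"
    and bounds: "\<And>z. z \<in> verts G \<Longrightarrow> 0 \<le> f z \<and> f z \<le> 1"
  shows "\<exists>a b. b - a = (1 - \<epsilon>) ^ k \<and>
    (\<forall>z\<in>verts G. a \<le> (lazy ^^ (m * k)) f z \<and> (lazy ^^ (m * k)) f z \<le> b)"
proof (induction k)
  case 0
  show ?case using bounds by (intro exI[of _ 0] exI[of _ 1]) simp
next
  case (Suc k)
  then obtain a b where ab: "b - a = (1 - \<epsilon>) ^ k"
    "\<And>z. z \<in> verts G \<Longrightarrow> a \<le> (lazy ^^ (m * k)) f z \<and> (lazy ^^ (m * k)) f z \<le> b" by blast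
  have "\<exists>a' b'. b' - a' = (1 - \<epsilon>) * (b - a) \<and> (\<forall>z\<in>verts G.
      a' \<le> (lazy ^^ m) ((lazy ^^ (m * k)) f) z \<and> (lazy ^^ m) ((lazy ^^ (m * k)) f) z \<le> b')"
    by (rule lazy_pow_contraction[OF v minor ab(2)])
  then show ?case by (simp add: ab(1) funpow_add)
qed

section \<open>Lazy return probabilities determine degrees\<close>

lemma lazy_return_near_stationary:
  assumes x: "x \<in> verts G"
    and bounds: "\<And>z. z \<in> verts G \<Longrightarrow> a \<le> (lazy ^^ n) (ind x) z \<and> (lazy ^^ n) (ind x) z \<le> b"
  shows "\<bar>deg x / (\<Sum>z\<in>verts G. real (deg z)) - (lazy ^^ n) (ind x) x\<bar> \<le> b - a"
proof -
  let ?S = "\<Sum>z\<in>verts G. real (deg z)"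
  have S: "?S > 0" using x deg_pos by (intro sum_pos2[of _ x]) auto
  \<comment> \<open>By stationarity, the degree-weighted mean of \<open>(lazy ^^ n) (ind x)\<close>
    is \<open>deg x / ?S\<close>. This mean and the value at \<open>x\<close> lie in the same
    interval from \<open>a\<close> to \<open>b\<close>.\<close>
  have "(\<Sum>z\<in>verts G. deg z * (lazy ^^ n) (ind x) z) = deg x"
    unfolding lazy_pow_stationary using x by (simp add: if_distrib cong: if_cong)
  moreover have "a * ?S \<le> (\<Sum>z\<in>verts G. deg z * (lazy ^^ n) (ind x) z)"
    unfolding mult.commute[of a] sum_distrib_right using bounds
    by (intro sum_mono mult_left_mono) auto
  moreover have "(\<Sum>z\<in>verts G. deg z * (lazy ^^ n) (ind x) z) \<le> b * ?S"
    unfolding mult.commute[of b] sum_distrib_right using bounds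
    by (intro sum_mono mult_left_mono) auto
  ultimately have "a \<le> deg x / ?S" "deg x / ?S \<le> b"
    using S by (simp_all only: pos_le_divide_eq pos_divide_le_eq)
  then show ?thesis using bounds[OF x] by linarith
qed

text \<open>Convergence along multiples of \<open>m\<close> suffices for comparing two vertices,
  because \<open>m\<close> comes from one fixed \<open>v\<close> and is the same for all
  \<open>x\<close>.\<close>

lemma lazy_return_tendsto_stationary:
  obtains m where "\<And>x. x \<in> verts G \<Longrightarrow>
    (\<lambda>k. (lazy ^^ (m * k)) (ind x) x) \<longlonglongrightarrow> deg x / (\<Sum>z\<in>verts G. real (deg z))"
proof -
  obtain v where v: "v \<in> verts G" using arcs_nonempty tail_in_verts by blast
  obtain m \<epsilon> where \<epsilon>: "\<epsilon> > 0" "\<epsilon> \<le> 1"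
    and minor: "\<And>x. x \<in> verts G \<Longrightarrow> (lazy ^^ m) (ind v) x \<ge> \<epsilon>"
    using lazy_minorization[OF v] by metis
  have "(\<lambda>k. (lazy ^^ (m * k)) (ind x) x) \<longlonglongrightarrow> deg x / (\<Sum>z\<in>verts G. real (deg z))"
    if x: "x \<in> verts G" for x
  proof (rule Lim_transform2[OF tendsto_const])
    have "\<bar>deg x / (\<Sum>z\<in>verts G. real (deg z)) - (lazy ^^ (m * k)) (ind x) x\<bar> \<le> (1 - \<epsilon>) ^ k"
      for k
    proof -
      have "\<exists>a b. b - a = (1 - \<epsilon>) ^ k \<and>
        (\<forall>z\<in>verts G. a \<le> (lazy ^^ (m * k)) (ind x) z \<and> (lazy ^^ (m * k)) (ind x) z \<le> b)"
        by (rule lazy_pow_oscillation[OF v minor]) simp_all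
      then obtain a b where ab: "b - a = (1 - \<epsilon>) ^ k"
        "\<And>z. z \<in> verts G \<Longrightarrow> a \<le> (lazy ^^ (m * k)) (ind x) z \<and> (lazy ^^ (m * k)) (ind x) z \<le> b"
        by blast
      show ?thesis using lazy_return_near_stationary[OF x ab(2)] unfolding ab(1) .
    qed
    then have "\<forall>\<^sub>F k in sequentially. norm (deg x / (\<Sum>z\<in>verts G. real (deg z))
        - (lazy ^^ (m * k)) (ind x) x) \<le> (1 - \<epsilon>) ^ k"
      by (simp only: real_norm_def eventually_True)
    moreover have "(\<lambda>k. (1 - \<epsilon>) ^ k) \<longlonglongrightarrow> 0" using \<epsilon> by (intro LIMSEQ_realpow_zero) auto
    ultimately show "(\<lambda>k. deg x / (\<Sum>z\<in>verts G. real (deg z)) - (lazy ^^ (m * k)) (ind x) x)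
      \<longlonglongrightarrow> 0"
      by (rule Lim_null_comparison)
  qed
  then show thesis using that by blast
qed

text \<open>A power of \<open>lazy\<close> is a binomial mixture of powers of \<open>avg\<close>.
  Carrying a general \<open>k\<close> through the induction avoids writing out the binomial
  expansion.\<close>

lemma lazy_return_eq:
  assumes "\<And>k. (avg ^^ k) (ind x) x = (avg ^^ k) (ind y) y"
  shows "(lazy ^^ n) ((avg ^^ k) (ind x)) x = (lazy ^^ n) ((avg ^^ k) (ind y)) y"
proof (induction n arbitrary: k)
  case 0
  show ?case by (simp add: assms)
next
  case (Suc n)
  \<comment> \<open>The innermost \<open>lazy\<close> is expanded, so that its \<open>avg\<close> is
    absorbed into the exponent \<open>k\<close>.\<close>
  have split: "(lazy ^^ Suc n) f = (\<lambda>z. ((lazy ^^ n) f z + (lazy ^^ n) (avg f) z) / 2)" for f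
  proof -
    have "lazy f = (\<lambda>z. (1/2) * f z + (1/2) * avg f z)" by (auto simp: lazy_def add_divide_distrib)
    then have "(lazy ^^ Suc n) f = (lazy ^^ n) (\<lambda>z. (1/2) * f z + (1/2) * avg f z)"
      by (simp only: funpow_Suc_right o_apply)
    also have "\<dots> = (\<lambda>z. ((lazy ^^ n) f z + (lazy ^^ n) (avg f) z) / 2)"
      by (subst lazy_pow_add) (simp only: lazy_pow_scale, simp add: add_divide_distrib)
    finally show ?thesis .
  qed
  show ?case unfolding split using Suc.IH[of k] Suc.IH[of "Suc k"] by simp
qed

text \<open>The two lazy return sequences coincide, so their limits do, and these are the degrees
  divided by the same total.\<close>

lemma deg_eq_if_return_prob_eq:
  assumes "x \<in> verts G" "y \<in> verts G" and "\<And>n. return_prob G n x = return_prob G n y"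
  shows "deg x = deg y"
proof -
  let ?S = "\<Sum>z\<in>verts G. real (deg z)"
  have S: "?S > 0" using assms(1) deg_pos by (intro sum_pos2[of _ x]) auto
  obtain m where lim: "\<And>z. z \<in> verts G \<Longrightarrow>
      (\<lambda>k. (lazy ^^ (m * k)) (ind z) z) \<longlonglongrightarrow> deg z / ?S"
    using lazy_return_tendsto_stationary by blast
  have "(lazy ^^ n) (ind x) x = (lazy ^^ n) (ind y) y" for n
    using lazy_return_eq[of x y n 0] assms by (simp add: return_prob_avg)
  then have "(\<lambda>k. (lazy ^^ (m * k)) (ind x) x) \<longlonglongrightarrow> deg y / ?S"
    using lim[OF assms(2)] by simp
  with lim[OF assms(1)] have "deg x / ?S = deg y / ?S" by (rule LIMSEQ_unique)
  moreover have "?S \<noteq> 0" using S by linarith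
  ultimately show ?thesis by (simp only: divide_cancel_right of_nat_eq_iff simp_thms)
qed

lemma walk_regular_iff_return_prob:
  "walk_regular G \<longleftrightarrow>
    (\<forall>n. \<forall>x\<in>verts G. \<forall>y\<in>verts G. return_prob G n x = return_prob G n y)"
proof -
  obtain v where v: "v \<in> verts G" using arcs_nonempty tail_in_verts by blast
  show ?thesis
  proof
    assume wr: "walk_regular G"
    have regular: "deg z = deg v" if "z \<in> verts G" for z
      using wr that v card_closed_walks_2 unfolding walk_regular_def by metis
    show "\<forall>n. \<forall>x\<in>verts G. \<forall>y\<in>verts G. return_prob G n x = return_prob G n y"
    proof (intro allI ballI)
      fix n x y assume xy: "x \<in> verts G" "y \<in> verts G"
      then have "real (deg v) ^ n * return_prob G n x = real (deg v) ^ n * return_prob G n y"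
        using wr card_closed_walks_regular[OF regular] unfolding walk_regular_def by metis
      \<comment> \<open>Nonemptiness of \<open>N v\<close> makes the factor \<open>deg v\<close>
        nonzero, so its power cancels.\<close>
      then show "return_prob G n x = return_prob G n y" using neighbours_nonempty[OF v] by simp
    qed
  next
    assume rp: "\<forall>n. \<forall>x\<in>verts G. \<forall>y\<in>verts G. return_prob G n x = return_prob G n y"
    have regular: "deg z = deg v" if "z \<in> verts G" for z
      using rp that v by (blast intro: deg_eq_if_return_prob_eq)
    show "walk_regular G"
      unfolding walk_regular_def
    proof (intro allI ballI)
      fix n x y assume "x \<in> verts G" "y \<in> verts G"
      then have "real (card (closed_walks G n x)) = real (card (closed_walks G n y))"
        using rp card_closed_walks_regular[OF regular] by metis
      then show "card (closed_walks G n x) = card (closed_walks G n y)" by simp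
    qed
  qed
qed

end

theorem mainTheorem1:
  fixes G :: "('a, 'b) pre_digraph"
  assumes "graph G"
    and "Digraph_Component.connected G"
    and "arcs G \<noteq> {}"
  shows "walk_regular G \<longleftrightarrow>
    (\<forall>n. \<forall>x\<in>verts G. \<forall>y\<in>verts G. return_prob G n x = return_prob G n y)"
proof -
  interpret connected_graph G
    using assms by (simp add: connected_graph_def connected_graph_axioms_def)
  show ?thesis by (rule walk_regular_iff_return_prob)
qed

end
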